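(* Let $f:\mathbb{R}^n\to\mathbb{R}$ be $\mathbf M$-smooth, $\mathbf M\succ0$, and $\mu$-strongly convex, $\mu>0$, with minimizer $x^*$. Let $S$ be a proper sampling with probability vector $p$ and probability matrix $\mathbf P$, and let $v\in\mathbb{R}^n$ satisfy $\mathbf P\circ\mathbf M\preceq\mathrm{Diag}(p)\,\mathrm{Diag}(v)$. Write $\hat{\mathbf P}=\mathrm{Diag}(p)$ and $\eta=\eta(v,p)=\max_i\frac{\sqrt{v_i}}{p_i}$. Choose $$c_1=\max\left(1,\ \eta^{-1}\frac{\sqrt\mu}{\min_ip_i}\right),\quad \alpha=\frac1{5\eta^2},\quad \tau=\frac{\sqrt{\frac{4}{9\cdot5^4}\eta^{-4}\mu^2+\frac8{75}\eta^{-2}\mu}-\frac2{75}\eta^{-2}\mu}{2},\quad \beta=\frac{2}{75\,\tau\,\eta^2},\quad \sigma=5\beta^2,$$ and let $$\Upsilon^k=\frac{2}{75}\frac{\eta^{-2}}{\tau^2}\left(\mathbb{E}[f(y^k)]-f(x^* )\right)+\frac{1+\beta\mu}{2}\mathbb{E}\left[\|z^k-x^*\|_2^2\right]+\sigma\,\mathbb{E}\left[\|h^k\|_{\hat{\mathbf P}^{-2}}^2\right],$$ where $y^k,z^k,h^k$ are the iterates of ASEGA with these parameters. Then for all $k\ge0$ $$\Upsilon^k\le\left(1-c_1^{-1}\tau\right)^k\Upsilon^0 .$$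
   Context: $\nabla f$ is the usual gradient; $\|x\|_{\mathbf W}^2=x^\top\mathbf Wx$; $\circ$ is the entrywise (Hadamard) product; $\preceq$ is the Loewner order. $f$ is $\mathbf M$-smooth if it is differentiable and $f(x)\le f(y)+\langle\nabla f(y),x-y\rangle+\frac12\|x-y\|_{\mathbf M}^2$ for all $x,y$; $\mu$-strongly convex if $f(x)\ge f(y)+\langle\nabla f(y),x-y\rangle+\frac\mu2\|x-y\|_2^2$ for all $x,y$. A sampling $S$ is a random subset of $\{1,\dots,n\}$; $p_i=\mathrm{Prob}(i\in S)$, $\mathbf P_{ij}=\mathrm{Prob}(\{i,j\}\subseteq S)$; $S$ is proper if all $p_i>0$. $\mathbf I_S$ is the column submatrix of the identity with columns $e_i$, $i\in S$. ASEGA with parameters $\alpha,\beta,\tau,\mu$: start from $y^0=z^0\in\mathbb{R}^n$ and $h^0\in\mathbb{R}^n$ (arbitrary); for $k=0,1,2,\dots$ set $x^{k+1}=(1-\tau)y^k+\tau z^k$, draw $S_k$, an independent copy of $S$, and set $g^k=h^k+\hat{\mathbf P}^{-1}\mathbf I_{S_k}\mathbf I_{S_k}^\top(\nabla f(x^{k+1})-h^k)$, $\;h^{k+1}=h^k+\mathbf I_{S_k}\mathbf I_{S_k}^\top(\nabla f(x^{k+1})-h^k)$, $y^{k+1}=x^{k+1}-\alpha\hat{\mathbf P}^{-1}g^k$, $\;z^{k+1}=\frac1{1+\beta\mu}\left(z^k+\beta\mu x^{k+1}-\beta g^k\right)$. *)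

theory Defs
  imports "HOL-Probability.Probability"
begin

definition Diag :: "real ^ 'n \<Rightarrow> real ^ 'n ^ 'n" where
  "Diag d = (\<chi> i j. if i = j then d $ i else 0)"

definition hadamard :: "real ^ 'n ^ 'm \<Rightarrow> real ^ 'n ^ 'm \<Rightarrow> real ^ 'n ^ 'm" where
  "hadamard A B = (\<chi> i j. A $ i $ j * B $ i $ j)"

definition psd :: "real ^ 'n ^ 'n \<Rightarrow> bool" where
  "psd A \<longleftrightarrow> transpose A = A \<and> (\<forall>x. 0 \<le> x \<bullet> (A *v x))"

definition pos_def :: "real ^ 'n ^ 'n \<Rightarrow> bool" where
  "pos_def A \<longleftrightarrow> transpose A = A \<and> (\<forall>x. x \<noteq> 0 \<longrightarrow> 0 < x \<bullet> (A *v x))"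

definition loewner_le :: "real ^ 'n ^ 'n \<Rightarrow> real ^ 'n ^ 'n \<Rightarrow> bool" where
  "loewner_le A B \<longleftrightarrow> psd (B - A)"

definition wnorm2 :: "real ^ 'n ^ 'n \<Rightarrow> real ^ 'n \<Rightarrow> real" where
  "wnorm2 W x = x \<bullet> (W *v x)"

text \<open>Meaningful only where \<open>f\<close> is differentiable; the gradient is then unique.\<close>

definition grad :: "(real ^ 'n \<Rightarrow> real) \<Rightarrow> real ^ 'n \<Rightarrow> real ^ 'n" where
  "grad f x = (THE D. GDERIV f x :> D)"

definition matrix_smooth :: "real ^ 'n ^ 'n \<Rightarrow> (real ^ 'n \<Rightarrow> real) \<Rightarrow> bool" where
  "matrix_smooth M f \<longleftrightarrow>
     (\<forall>x. f differentiable (at x)) \<and>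
     (\<forall>x y. f x \<le> f y + grad f y \<bullet> (x - y) + 1 / 2 * wnorm2 M (x - y))"

text \<open>Differentiability is not part of this predicate; it is used together with
  \<^const>\<open>matrix_smooth\<close>, which provides it.\<close>

definition strongly_convex :: "real \<Rightarrow> (real ^ 'n \<Rightarrow> real) \<Rightarrow> bool" where
  "strongly_convex \<mu> f \<longleftrightarrow>
     (\<forall>x y. f x \<ge> f y + grad f y \<bullet> (x - y) + \<mu> / 2 * (norm (x - y))\<^sup>2)"

definition sampling :: "'w measure \<Rightarrow> ('w \<Rightarrow> 'n::finite set) \<Rightarrow> bool" where
  "sampling \<Omega> S \<longleftrightarrow> prob_space \<Omega> \<and> S \<in> measurable \<Omega> (count_space UNIV)"

definition prob_vector :: "'w measure \<Rightarrow> ('w \<Rightarrow> 'n::finite set) \<Rightarrow> real ^ 'n" where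
  "prob_vector \<Omega> S = (\<chi> i. measure \<Omega> {\<omega> \<in> space \<Omega>. i \<in> S \<omega>})"

definition prob_matrix :: "'w measure \<Rightarrow> ('w \<Rightarrow> 'n::finite set) \<Rightarrow> real ^ 'n ^ 'n" where
  "prob_matrix \<Omega> S = (\<chi> i j. measure \<Omega> {\<omega> \<in> space \<Omega>. {i, j} \<subseteq> S \<omega>})"

definition proper_sampling :: "'w measure \<Rightarrow> ('w \<Rightarrow> 'n::finite set) \<Rightarrow> bool" where
  "proper_sampling \<Omega> S \<longleftrightarrow> sampling \<Omega> S \<and> (\<forall>i. 0 < prob_vector \<Omega> S $ i)"

definition independent_copies ::
  "'w measure \<Rightarrow> ('w \<Rightarrow> 'n::finite set) \<Rightarrow> (nat \<Rightarrow> 'w \<Rightarrow> 'n set) \<Rightarrow> bool" where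
  "independent_copies \<Omega> S Sk \<longleftrightarrow>
     prob_space.indep_vars \<Omega> (\<lambda>_. count_space UNIV) Sk UNIV \<and>
     (\<forall>k. distr \<Omega> (count_space UNIV) (Sk k) = distr \<Omega> (count_space UNIV) S)"

text \<open>The square matrix \<open>I\<^sub>S I\<^sub>S\<^sup>T\<close>. The number of columns of \<open>I\<^sub>S\<close> depends on the
  set \<open>S\<close>, so only the product, the sum of \<open>e\<^sub>s e\<^sub>s\<^sup>T\<close> over \<open>s \<in> S\<close>, is given a type.\<close>

definition sel_matrix :: "'n::finite set \<Rightarrow> real ^ 'n ^ 'n" where
  "sel_matrix S = (\<chi> i j. \<Sum>s\<in>S. axis s 1 $ i * axis s 1 $ j)"

text \<open>Iterates along one realisation \<open>s\<close> of the sequence of samples; the value at \<open>k\<close> is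
  the triple of the \<open>y\<close>-, \<open>z\<close>- and \<open>h\<close>-iterate with index \<open>k\<close>.\<close>

primrec asega ::
  "(real ^ 'n \<Rightarrow> real) \<Rightarrow> real ^ 'n \<Rightarrow> real \<Rightarrow> real \<Rightarrow> real \<Rightarrow> real \<Rightarrow>
   real ^ 'n \<Rightarrow> real ^ 'n \<Rightarrow> (nat \<Rightarrow> 'n::finite set) \<Rightarrow> nat \<Rightarrow>
   (real ^ 'n) \<times> (real ^ 'n) \<times> (real ^ 'n)" where
  "asega f p \<alpha> \<beta> \<tau> \<mu> y0 h0 s 0 = (y0, y0, h0)"
| "asega f p \<alpha> \<beta> \<tau> \<mu> y0 h0 s (Suc k) =
     (let (y, z, h) = asega f p \<alpha> \<beta> \<tau> \<mu> y0 h0 s k;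
          Pinv = matrix_inv (Diag p);
          x = (1 - \<tau>) *\<^sub>R y + \<tau> *\<^sub>R z;
          d = sel_matrix (s k) *v (grad f x - h);
          g = h + Pinv *v d
      in (x - \<alpha> *\<^sub>R (Pinv *v g),
          (1 / (1 + \<beta> * \<mu>)) *\<^sub>R (z + (\<beta> * \<mu>) *\<^sub>R x - \<beta> *\<^sub>R g),
          h + d))"

end

theory Submission
  imports Defs
begin

text \<open>The rate holds because one step shrinks the potential in expectation by the factor
  \<open>1 - \<tau> / c\<^sub>1\<close>, whatever the current state is (\<open>mean_potential_step\<close>). As the draw of a
  step is independent of the state before it, this inequality can be averaged over the
  state and iterated (locale \<open>driven_recursion\<close>).

  For a single step, let \<open>d\<close> be the gradient at \<open>x\<close>, and let \<open>a\<close> and \<open>b\<close> be the squared norms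
  of \<open>d\<close> and of the control variate \<open>h\<close> with weight \<open>Diag p\<^sup>-\<^sup>1\<close>. The estimate \<open>g\<close> is
  unbiased. Its second moment is at most \<open>2 (a + b)\<close> in the Euclidean norm, and at most
  \<open>2 \<eta>\<^sup>2 (a + b)\<close> in the norm of \<open>M\<close> after the scaling by \<open>Diag p\<^sup>-\<^sup>1\<close>; the second bound is
  where \<open>v\<close> enters (\<open>mean_wnorm2_estimate\<close>). This has three consequences. Smoothness makes
  the move from \<open>x\<close> to \<open>y\<close> decrease \<open>f\<close> by a multiple of \<open>a\<close>, up to a multiple of \<open>b\<close>
  (\<open>mean_gradient_move\<close>). The move of \<open>z\<close> obeys the usual mirror descent inequality with
  error \<open>\<beta>\<^sup>2 (a + b)\<close> (\<open>mean_mirror_move\<close>). The expected change of the weighted square of \<open>h\<close> is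
  exactly \<open>a - b\<close> (\<open>mean_control_update\<close>), which is the variance reduction.

  Strong convexity links the first two bounds by linear coupling (\<open>coupling\<close>). In the
  weighted sum the terms in \<open>a\<close> cancel, and a negative multiple of \<open>b\<close> is left. It shrinks
  the last term of the potential by a factor \<open>1 - min p / 2\<close>, while the other terms shrink
  by \<open>1 - \<tau>\<close>. The constant \<open>c\<^sub>1\<close> is chosen so that \<open>1 - \<tau> / c\<^sub>1\<close> is at least both factors.\<close>

section \<open>Diagonal and selection matrices, quadratic forms\<close>

lemma Diag_mult_vec [simp]: "(Diag d *v u) $ i = d $ i * u $ i"
  by (simp add: Diag_def matrix_vector_mult_def if_distrib if_distribR cong: if_cong)

lemma Diag_mult_Diag: "Diag a ** Diag b = Diag (\<chi> i. a $ i * b $ i)"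
  by (simp add: matrix_eq vec_eq_iff flip: matrix_vector_mul_assoc)

lemma matrix_inv_Diag:
  assumes "\<And>i. p $ i \<noteq> 0"
  shows "matrix_inv (Diag p) = Diag (\<chi> i. 1 / p $ i)"
proof -
  let ?D = "Diag (\<chi> i. 1 / p $ i)"
  have *: "Diag p ** ?D = mat 1" "?D ** Diag p = mat 1"
    unfolding Diag_mult_Diag using assms by (simp_all add: Diag_def mat_def vec_eq_iff)
  then have "invertible (Diag p)"
    by (auto simp: invertible_def)
  then have "matrix_inv (Diag p) ** Diag p = mat 1"
    unfolding matrix_inv_def invertible_def by (rule someI2_ex) simp
  then have "(matrix_inv (Diag p) ** Diag p) ** ?D = ?D"
    by (simp only: matrix_mul_lid)
  then show ?thesis
    by (simp only: *(1) matrix_mul_rid flip: matrix_mul_assoc)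
qed

lemma sel_matrix_mult_vec [simp]:
  "(sel_matrix A *v u) $ i = (if i \<in> A then u $ i else 0)"
proof -
  have "sel_matrix A $ i $ j = (if i = j \<and> i \<in> A then 1 else 0)" for j
  proof -
    have "sel_matrix A $ i $ j = (\<Sum>s\<in>A. if s = i then (if i = j then 1 else 0) else 0)"
      unfolding sel_matrix_def axis_def vec_lambda_beta by (rule sum.cong) auto
    then show ?thesis
      by simp
  qed
  then have "(sel_matrix A *v u) $ i = (\<Sum>j\<in>UNIV. if j = i then (if i \<in> A then u $ i else 0) else 0)"
    unfolding matrix_vector_mult_def vec_lambda_beta by (intro sum.cong) auto
  then show ?thesis
    by simp
qed

lemma wnorm2_sum: "wnorm2 W x = (\<Sum>i\<in>UNIV. \<Sum>j\<in>UNIV. W $ i $ j * (x $ i * x $ j))"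
  unfolding wnorm2_def inner_vec_def matrix_vector_mult_def
  by (simp add: sum_distrib_left mult_ac)

lemma wnorm2_Diag: "wnorm2 (Diag d) x = (\<Sum>i\<in>UNIV. d $ i * (x $ i)\<^sup>2)"
  unfolding wnorm2_def inner_vec_def by (simp add: power2_eq_square mult_ac)

lemma psd_wnorm2_nonneg: "psd W \<Longrightarrow> 0 \<le> wnorm2 W x"
  by (simp add: psd_def wnorm2_def)

lemma psd_inner_commute: "psd W \<Longrightarrow> x \<bullet> (W *v y) = (W *v x) \<bullet> y"
  by (metis psd_def dot_lmul_matrix transpose_matrix_vector)

lemma wnorm2_diff:
  assumes "psd W"
  shows "wnorm2 W (x - y) = wnorm2 W x - 2 * ((W *v x) \<bullet> y) + wnorm2 W y"
  using psd_inner_commute[OF assms, of x y]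
  unfolding wnorm2_def
  by (simp add: matrix_vector_mult_diff_distrib inner_diff_left inner_diff_right inner_commute)

lemma wnorm2_add_le:
  assumes "psd W"
  shows "wnorm2 W (x + y) \<le> 2 * wnorm2 W x + 2 * wnorm2 W y"
proof -
  have "wnorm2 W (x + y) = wnorm2 W x + 2 * ((W *v x) \<bullet> y) + wnorm2 W y"
    using wnorm2_diff[OF assms, of x "- y"]
    by (simp add: wnorm2_def vec.neg)
  moreover have "0 \<le> wnorm2 W (x - y)"
    by (rule psd_wnorm2_nonneg[OF assms])
  ultimately show ?thesis
    using wnorm2_diff[OF assms, of x y] by linarith
qed

section \<open>Averages over a random index set\<close>

text \<open>A sampling of a finite index set enters only through the probabilities \<open>q A\<close> of
  its values \<open>A\<close>, so the analysis of a single step needs finite weighted sums only.\<close>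

locale finite_sampling =
  fixes q :: "'n::finite set \<Rightarrow> real" and p :: "real ^ 'n"
  assumes q_nonneg: "0 \<le> q A"
    and q_sum: "(\<Sum>A\<in>UNIV. q A) = 1"
    and p_eq: "p $ i = (\<Sum>A | i \<in> A. q A)"
    and p_pos: "0 < p $ i"
begin

definition mean :: "('n set \<Rightarrow> real) \<Rightarrow> real" where
  "mean \<phi> = (\<Sum>A\<in>UNIV. q A * \<phi> A)"

definition pair_matrix :: "real ^ 'n ^ 'n" where
  "pair_matrix = (\<chi> i j. \<Sum>A | {i, j} \<subseteq> A. q A)"

lemma mean_const [simp]: "mean (\<lambda>_. c) = c"
  by (simp add: mean_def q_sum flip: sum_distrib_right)

lemma mean_add: "mean (\<lambda>A. \<phi> A + \<psi> A) = mean \<phi> + mean \<psi>"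
  by (simp add: mean_def distrib_left sum.distrib)

lemma mean_diff: "mean (\<lambda>A. \<phi> A - \<psi> A) = mean \<phi> - mean \<psi>"
  by (simp add: mean_def right_diff_distrib sum_subtractf)

lemma mean_mult: "mean (\<lambda>A. c * \<phi> A) = c * mean \<phi>"
  by (simp add: mean_def sum_distrib_left mult_ac)

lemma mean_sum: "mean (\<lambda>A. \<Sum>i\<in>I. \<phi> i A) = (\<Sum>i\<in>I. mean (\<phi> i))"
  unfolding mean_def sum_distrib_left by (rule sum.swap)

lemma mean_mono: "(\<And>A. \<phi> A \<le> \<psi> A) \<Longrightarrow> mean \<phi> \<le> mean \<psi>"
  unfolding mean_def by (intro sum_mono mult_left_mono q_nonneg)

lemma mean_member: "mean (\<lambda>A. if i \<in> A then a else b) = p $ i * a + (1 - p $ i) * b"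
proof -
  have 1: "mean (\<lambda>A. if i \<in> A then 1 else 0) = p $ i"
    unfolding mean_def p_eq by (simp add: if_distrib sum.inter_filter[symmetric] cong: if_cong)
  have "mean (\<lambda>A. if i \<in> A then a else b) = mean (\<lambda>A. (a - b) * (if i \<in> A then 1 else 0) + b)"
    by (rule arg_cong[of _ _ mean]) auto
  also have "\<dots> = (a - b) * p $ i + b"
    by (simp only: mean_add mean_mult mean_const 1)
  finally show ?thesis
    by (simp add: algebra_simps)
qed

lemma mean_inner:
  assumes "\<And>i. mean (\<lambda>A. Z A $ i) = b $ i"
  shows "mean (\<lambda>A. c \<bullet> Z A) = c \<bullet> b"
  by (simp add: inner_vec_def mean_sum mean_mult assms)

text \<open>Selecting coordinates at random multiplies the entries of a quadratic form by the
  pair probabilities. This is why the Hadamard product with the probability matrix appears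
  in the assumption on \<open>v\<close>.\<close>

lemma mean_wnorm2_sel:
  "mean (\<lambda>A. wnorm2 W (sel_matrix A *v u)) = wnorm2 (hadamard pair_matrix W) u"
proof -
  have "mean (\<lambda>A. W $ i $ j * ((sel_matrix A *v u) $ i * (sel_matrix A *v u) $ j))
      = hadamard pair_matrix W $ i $ j * (u $ i * u $ j)" for i j
  proof -
    have "mean (\<lambda>A. W $ i $ j * ((sel_matrix A *v u) $ i * (sel_matrix A *v u) $ j))
        = (\<Sum>A\<in>UNIV. if {i, j} \<subseteq> A then q A * (W $ i $ j * (u $ i * u $ j)) else 0)"
      unfolding mean_def by (rule sum.cong) auto
    also have "\<dots> = (\<Sum>A | {i, j} \<subseteq> A. q A) * (W $ i $ j * (u $ i * u $ j))"
      by (simp add: sum_distrib_right sum.If_cases Int_def)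
    finally show ?thesis
      by (simp add: hadamard_def pair_matrix_def mult_ac)
  qed
  then show ?thesis
    by (simp only: wnorm2_sum mean_sum)
qed

lemma mean_wnorm2_centred:
  assumes "psd W" and "\<And>i. mean (\<lambda>A. Z A $ i) = b $ i"
  shows "mean (\<lambda>A. wnorm2 W (b - Z A)) \<le> mean (\<lambda>A. wnorm2 W (Z A))"
proof -
  have "mean (\<lambda>A. wnorm2 W (b - Z A))
      = wnorm2 W b - 2 * ((W *v b) \<bullet> b) + mean (\<lambda>A. wnorm2 W (Z A))"
    by (simp only: wnorm2_diff[OF assms(1)] mean_add mean_diff mean_mult mean_const
        mean_inner[OF assms(2)])
  also have "(W *v b) \<bullet> b = wnorm2 W b"
    by (simp add: wnorm2_def inner_commute)
  finally show ?thesis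
    using psd_wnorm2_nonneg[OF assms(1), of b] by simp
qed

text \<open>The squared norm with weight \<open>Diag p\<^sup>-\<^sup>1\<close>. The expected decrease of \<open>f\<close>, the second
  moment of the estimate and the expected change of the control variate are all multiples
  of it, so that they can be traded against each other.\<close>

definition dual_norm2 :: "real ^ 'n \<Rightarrow> real" where
  "dual_norm2 u = (\<Sum>i\<in>UNIV. (u $ i)\<^sup>2 / p $ i)"

definition estimate :: "real ^ 'n \<Rightarrow> real ^ 'n \<Rightarrow> 'n set \<Rightarrow> real ^ 'n" where
  "estimate d h A = h + matrix_inv (Diag p) *v (sel_matrix A *v (d - h))"

lemma p_nonzero [simp]: "p $ i \<noteq> 0"
  using p_pos[of i] by simp

lemma inv_Diag_p [simp]: "(matrix_inv (Diag p) *v u) $ i = u $ i / p $ i"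
  by (simp add: matrix_inv_Diag)

lemma mean_estimate: "mean (\<lambda>A. estimate d h A $ i) = d $ i"
proof -
  have "estimate d h A $ i = (if i \<in> A then h $ i + (d $ i - h $ i) / p $ i else h $ i)" for A
    by (simp add: estimate_def)
  then show ?thesis
    by (simp add: mean_member algebra_simps diff_divide_distrib)
qed

text \<open>The estimate splits into an unbiased sparse estimate of \<open>d\<close> and the error of the
  unbiased sparse estimate of \<open>h\<close>. The second part is centred, so its second moment is at
  most that of the sparse estimate itself.\<close>

lemma mean_wnorm2_estimate:
  assumes W: "psd W"
    and bound: "\<And>u. mean (\<lambda>A. wnorm2 W (sel_matrix A *v u)) \<le> K * (\<Sum>i\<in>UNIV. p $ i * (u $ i)\<^sup>2)"
  shows "mean (\<lambda>A. wnorm2 W (estimate d h A)) \<le> 2 * K * (dual_norm2 d + dual_norm2 h)"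
proof -
  define D where "D = (\<lambda>u. matrix_inv (Diag p) *v u)"
  have split: "estimate d h A = sel_matrix A *v D d + (h - sel_matrix A *v D h)" for A
    by (simp add: vec_eq_iff estimate_def D_def diff_divide_distrib)
  have sparse: "mean (\<lambda>A. wnorm2 W (sel_matrix A *v D u)) \<le> K * dual_norm2 u" for u
    using bound[of "D u"] by (simp add: D_def dual_norm2_def power2_eq_square)
  have "mean (\<lambda>A. (sel_matrix A *v D h) $ i) = h $ i" for i
    by (simp add: mean_member D_def)
  then have "mean (\<lambda>A. wnorm2 W (h - sel_matrix A *v D h)) \<le> K * dual_norm2 h"
    by (intro order_trans[OF mean_wnorm2_centred[OF W] sparse])
  moreover have "mean (\<lambda>A. wnorm2 W (estimate d h A))
      \<le> mean (\<lambda>A. 2 * wnorm2 W (sel_matrix A *v D d) + 2 * wnorm2 W (h - sel_matrix A *v D h))"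
    unfolding split by (rule mean_mono) (rule wnorm2_add_le[OF W])
  ultimately show ?thesis
    using sparse[of d] by (simp add: mean_add mean_mult algebra_simps)
qed

text \<open>A coordinate of \<open>h\<close> is refreshed with probability \<open>p\<^sub>i\<close> only. The extra factor
  \<open>1 / p\<^sub>i\<close> in the weight \<open>Diag p\<^sup>-\<^sup>2\<close> makes up for that and turns the expected change into a
  difference of dual norms.\<close>

lemma mean_control_update:
  "mean (\<lambda>A. wnorm2 (matrix_inv (Diag p) ** matrix_inv (Diag p)) (h + sel_matrix A *v (d - h)))
    = wnorm2 (matrix_inv (Diag p) ** matrix_inv (Diag p)) h - dual_norm2 h + dual_norm2 d"
proof -
  have w: "wnorm2 (matrix_inv (Diag p) ** matrix_inv (Diag p)) u
      = (\<Sum>i\<in>UNIV. 1 / (p $ i * p $ i) * (u $ i)\<^sup>2)" for u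
    by (simp add: matrix_inv_Diag Diag_mult_Diag wnorm2_Diag)
  have "mean (\<lambda>A. ((h + sel_matrix A *v (d - h)) $ i)\<^sup>2)
      = p $ i * (d $ i)\<^sup>2 + (1 - p $ i) * (h $ i)\<^sup>2" for i
  proof -
    have "((h + sel_matrix A *v (d - h)) $ i)\<^sup>2 = (if i \<in> A then (d $ i)\<^sup>2 else (h $ i)\<^sup>2)" for A
      by simp
    then show ?thesis
      by (simp only: mean_member)
  qed
  then have "mean (\<lambda>A. wnorm2 (matrix_inv (Diag p) ** matrix_inv (Diag p)) (h + sel_matrix A *v (d - h)))
      = (\<Sum>i\<in>UNIV. 1 / (p $ i * p $ i) * (p $ i * (d $ i)\<^sup>2 + (1 - p $ i) * (h $ i)\<^sup>2))"
    by (simp only: w mean_sum mean_mult)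
  also have "\<dots> = (\<Sum>i\<in>UNIV. 1 / (p $ i * p $ i) * (h $ i)\<^sup>2 - (h $ i)\<^sup>2 / p $ i + (d $ i)\<^sup>2 / p $ i)"
    by (rule sum.cong) (simp_all add: field_simps)
  finally show ?thesis
    by (simp only: w dual_norm2_def sum.distrib sum_subtractf)
qed

lemma dual_norm2_ge_weighted:
  assumes "\<And>i. 2 * r \<le> p $ i"
  shows "2 * r * wnorm2 (matrix_inv (Diag p) ** matrix_inv (Diag p)) h \<le> dual_norm2 h"
proof -
  have "2 * r * (1 / (p $ i * p $ i) * (h $ i)\<^sup>2) \<le> (h $ i)\<^sup>2 / p $ i" for i
  proof -
    have "2 * r * ((h $ i)\<^sup>2 / (p $ i * p $ i)) \<le> p $ i * ((h $ i)\<^sup>2 / (p $ i * p $ i))"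
      by (rule mult_right_mono[OF assms]) simp
    then show ?thesis by simp
  qed
  then show ?thesis
    by (auto simp: matrix_inv_Diag Diag_mult_Diag wnorm2_Diag dual_norm2_def sum_distrib_left
        intro!: sum_mono)
qed

section \<open>One step of the method\<close>

text \<open>The scaling by \<open>Diag p\<^sup>-\<^sup>1\<close> after the estimate is absorbed into the quadratic form. For
  the resulting matrix \<open>W\<close> the sparse second moment has weights \<open>v\<^sub>i / p\<^sub>i\<close> in place of
  \<open>p\<^sub>i v\<^sub>i\<close>, and \<open>\<eta>\<^sup>2 p\<^sub>i\<close> dominates these. The same scaling makes the linear term of the
  smoothness inequality the dual norm of the gradient.\<close>

lemma mean_gradient_move:
  assumes M: "psd M" "matrix_smooth M f"
    and eso: "\<And>u. wnorm2 (hadamard pair_matrix M) u \<le> (\<Sum>i\<in>UNIV. p $ i * v $ i * (u $ i)\<^sup>2)"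
    and v: "\<And>i. v $ i \<le> \<eta>\<^sup>2 * (p $ i)\<^sup>2"
  shows "mean (\<lambda>A. f (x - \<alpha> *\<^sub>R (matrix_inv (Diag p) *v estimate (grad f x) h A)))
    \<le> f x - \<alpha> * dual_norm2 (grad f x)
        + \<alpha>\<^sup>2 * \<eta>\<^sup>2 * (dual_norm2 (grad f x) + dual_norm2 h)"
proof -
  define D where "D = (\<lambda>u. matrix_inv (Diag p) *v u)"
  define W where "W = (\<chi> i j. M $ i $ j / (p $ i * p $ j))"
  define G where "G = estimate (grad f x) h"
  have W_eq: "wnorm2 W u = wnorm2 M (D u)" for u
    by (simp add: wnorm2_sum W_def D_def)
  have "psd W"
    using M(1) psd_wnorm2_nonneg[OF M(1)] W_eq
    by (simp add: psd_def W_def transpose_def vec_eq_iff mult.commute flip: wnorm2_def)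
  moreover have "mean (\<lambda>A. wnorm2 W (sel_matrix A *v u)) \<le> \<eta>\<^sup>2 * (\<Sum>i\<in>UNIV. p $ i * (u $ i)\<^sup>2)" for u
  proof -
    have "D (sel_matrix A *v u) = sel_matrix A *v D u" for A
      by (simp add: D_def vec_eq_iff)
    then have "mean (\<lambda>A. wnorm2 W (sel_matrix A *v u)) = wnorm2 (hadamard pair_matrix M) (D u)"
      by (simp add: W_eq mean_wnorm2_sel)
    also have "\<dots> \<le> (\<Sum>i\<in>UNIV. p $ i * v $ i * (D u $ i)\<^sup>2)"
      by (rule eso)
    also have "\<dots> \<le> (\<Sum>i\<in>UNIV. p $ i * (\<eta>\<^sup>2 * (p $ i)\<^sup>2) * (D u $ i)\<^sup>2)"
      by (intro sum_mono mult_right_mono mult_left_mono v) (simp_all add: p_pos less_imp_le)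
    also have "\<dots> = \<eta>\<^sup>2 * (\<Sum>i\<in>UNIV. p $ i * (u $ i)\<^sup>2)"
      by (simp add: D_def sum_distrib_left power_divide mult_ac)
    finally show ?thesis .
  qed
  ultimately have 2: "mean (\<lambda>A. wnorm2 W (G A))
      \<le> 2 * \<eta>\<^sup>2 * (dual_norm2 (grad f x) + dual_norm2 h)"
    unfolding G_def by (rule mean_wnorm2_estimate)
  have self_adj: "grad f x \<bullet> D u = D (grad f x) \<bullet> u" for u
    by (simp add: D_def inner_vec_def)
  have 1: "mean (\<lambda>A. grad f x \<bullet> D (G A)) = dual_norm2 (grad f x)"
    unfolding self_adj G_def mean_inner[OF mean_estimate]
    by (simp add: D_def dual_norm2_def inner_vec_def power2_eq_square)
  have "f (x - \<alpha> *\<^sub>R D g) \<le> f x - \<alpha> * (grad f x \<bullet> D g) + \<alpha>\<^sup>2 / 2 * wnorm2 W g" for g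
  proof -
    have "f (x - \<alpha> *\<^sub>R D g) \<le> f x + grad f x \<bullet> (x - \<alpha> *\<^sub>R D g - x)
        + 1 / 2 * wnorm2 M (x - \<alpha> *\<^sub>R D g - x)"
      using M(2) unfolding matrix_smooth_def by blast
    moreover have "wnorm2 M (x - \<alpha> *\<^sub>R D g - x) = \<alpha>\<^sup>2 * wnorm2 W g"
      unfolding W_eq
      by (simp add: wnorm2_sum D_def sum_distrib_left power2_eq_square mult_ac)
    ultimately show ?thesis by simp
  qed
  then have "mean (\<lambda>A. f (x - \<alpha> *\<^sub>R D (G A)))
      \<le> mean (\<lambda>A. f x - \<alpha> * (grad f x \<bullet> D (G A)) + \<alpha>\<^sup>2 / 2 * wnorm2 W (G A))"
    by (rule mean_mono)
  also have "\<dots> = f x - \<alpha> * dual_norm2 (grad f x) + \<alpha>\<^sup>2 / 2 * mean (\<lambda>A. wnorm2 W (G A))"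
    by (simp only: mean_add mean_diff mean_mult mean_const 1)
  also have "\<dots> \<le> f x - \<alpha> * dual_norm2 (grad f x)
      + \<alpha>\<^sup>2 / 2 * (2 * \<eta>\<^sup>2 * (dual_norm2 (grad f x) + dual_norm2 h))"
    by (intro add_left_mono mult_left_mono 2) simp
  finally show ?thesis
    by (simp add: D_def G_def mult_ac)
qed

end

text \<open>The new point is a convex combination of \<open>z - \<beta> g\<close> and \<open>x\<close>, so convexity of the
  squared norm gives the bound.\<close>

lemma mirror_move:
  fixes x z g w :: "'a::real_inner"
  assumes "0 \<le> t"
  shows "(1 + t) / 2 * (norm ((1 / (1 + t)) *\<^sub>R (z + t *\<^sub>R x - \<beta> *\<^sub>R g) - w))\<^sup>2
    \<le> 1 / 2 * (norm (z - w))\<^sup>2 + t / 2 * (norm (x - w))\<^sup>2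
        - \<beta> * (g \<bullet> (z - w)) + \<beta>\<^sup>2 / 2 * (g \<bullet> g)"
proof -
  define a b c where "a = z - w" and "b = x - w" and "c = a - \<beta> *\<^sub>R g"
  have "(1 / (1 + t)) *\<^sub>R (z + t *\<^sub>R x - \<beta> *\<^sub>R g) - w
      = (1 / (1 + t)) *\<^sub>R ((z + t *\<^sub>R x - \<beta> *\<^sub>R g) - (1 + t) *\<^sub>R w)"
    using assms by (simp add: scaleR_diff_right)
  also have "(z + t *\<^sub>R x - \<beta> *\<^sub>R g) - (1 + t) *\<^sub>R w = c + t *\<^sub>R b"
    by (simp add: a_def b_def c_def algebra_simps)
  finally have "(1 + t) / 2 * (norm ((1 / (1 + t)) *\<^sub>R (z + t *\<^sub>R x - \<beta> *\<^sub>R g) - w))\<^sup>2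
      = (norm (c + t *\<^sub>R b))\<^sup>2 / (2 * (1 + t))"
    using assms by (simp add: power_divide power2_eq_square)
  also have "\<dots> \<le> (c \<bullet> c + t * (b \<bullet> b)) / 2"
  proof -
    have "(1 + t) * (c \<bullet> c + t * (b \<bullet> b)) - (norm (c + t *\<^sub>R b))\<^sup>2 = t * (norm (c - b))\<^sup>2"
      unfolding power2_norm_eq_inner by (simp add: algebra_simps inner_commute)
    moreover have "0 \<le> t * (norm (c - b))\<^sup>2"
      using assms by simp
    ultimately have "(norm (c + t *\<^sub>R b))\<^sup>2 \<le> (1 + t) * (c \<bullet> c + t * (b \<bullet> b))"
      by linarith
    then show ?thesis
      using assms by (simp add: field_simps)
  qed
  also have "c \<bullet> c = a \<bullet> a - 2 * \<beta> * (g \<bullet> a) + \<beta>\<^sup>2 * (g \<bullet> g)"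
    by (simp add: c_def algebra_simps inner_commute power2_eq_square)
  finally show ?thesis
    unfolding power2_norm_eq_inner a_def b_def by (simp add: field_simps)
qed

context finite_sampling
begin

lemma mean_mirror_move:
  assumes "0 \<le> t"
  shows "mean (\<lambda>A. (1 + t) / 2 * (norm ((1 / (1 + t)) *\<^sub>R (z + t *\<^sub>R x - \<beta> *\<^sub>R estimate d h A) - w))\<^sup>2)
    \<le> 1 / 2 * (norm (z - w))\<^sup>2 + t / 2 * (norm (x - w))\<^sup>2
        - \<beta> * (d \<bullet> (z - w)) + \<beta>\<^sup>2 * (dual_norm2 d + dual_norm2 h)"
proof -
  have w1: "wnorm2 (mat 1) u = u \<bullet> u" for u :: "real ^ 'n"
    by (simp add: wnorm2_def)
  have "mean (\<lambda>A. wnorm2 (mat 1) (sel_matrix A *v u)) = 1 * (\<Sum>i\<in>UNIV. p $ i * (u $ i)\<^sup>2)" for u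
  proof -
    have "wnorm2 (mat 1) (sel_matrix A *v u) = (\<Sum>i\<in>UNIV. if i \<in> A then (u $ i)\<^sup>2 else 0)" for A
      unfolding w1 inner_vec_def by (rule sum.cong) (auto simp: power2_eq_square)
    then show ?thesis
      by (simp add: mean_sum mean_member)
  qed
  moreover have "psd (mat 1 :: real ^ 'n ^ 'n)"
    by (simp add: psd_def)
  ultimately have 2: "mean (\<lambda>A. wnorm2 (mat 1) (estimate d h A)) \<le> 2 * 1 * (dual_norm2 d + dual_norm2 h)"
    by (intro mean_wnorm2_estimate) simp_all
  have 1: "mean (\<lambda>A. estimate d h A \<bullet> (z - w)) = d \<bullet> (z - w)"
    using mean_inner[OF mean_estimate, of "z - w" d h] by (simp add: inner_commute)
  have "mean (\<lambda>A. (1 + t) / 2 * (norm ((1 / (1 + t)) *\<^sub>R (z + t *\<^sub>R x - \<beta> *\<^sub>R estimate d h A) - w))\<^sup>2)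
    \<le> mean (\<lambda>A. 1 / 2 * (norm (z - w))\<^sup>2 + t / 2 * (norm (x - w))\<^sup>2
        - \<beta> * (estimate d h A \<bullet> (z - w)) + \<beta>\<^sup>2 / 2 * (estimate d h A \<bullet> estimate d h A))"
    by (intro mean_mono mirror_move assms)
  also have "\<dots> = 1 / 2 * (norm (z - w))\<^sup>2 + t / 2 * (norm (x - w))\<^sup>2
        - \<beta> * (d \<bullet> (z - w)) + \<beta>\<^sup>2 / 2 * mean (\<lambda>A. wnorm2 (mat 1) (estimate d h A))"
    by (simp only: mean_add mean_diff mean_mult mean_const 1 w1)
  also have "\<dots> \<le> 1 / 2 * (norm (z - w))\<^sup>2 + t / 2 * (norm (x - w))\<^sup>2
        - \<beta> * (d \<bullet> (z - w)) + \<beta>\<^sup>2 / 2 * (2 * 1 * (dual_norm2 d + dual_norm2 h))"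
    by (intro add_left_mono mult_left_mono 2) simp
  also have "\<beta>\<^sup>2 / 2 * (2 * 1 * (dual_norm2 d + dual_norm2 h)) = \<beta>\<^sup>2 * (dual_norm2 d + dual_norm2 h)"
    by simp
  finally show ?thesis .
qed

end

definition asega_step ::
  "(real ^ 'n \<Rightarrow> real) \<Rightarrow> real ^ 'n \<Rightarrow> real \<Rightarrow> real \<Rightarrow> real \<Rightarrow> real \<Rightarrow>
   (real ^ 'n) \<times> (real ^ 'n) \<times> (real ^ 'n) \<Rightarrow> 'n::finite set \<Rightarrow>
   (real ^ 'n) \<times> (real ^ 'n) \<times> (real ^ 'n)" where
  "asega_step f p \<alpha> \<beta> \<tau> \<mu> = (\<lambda>(y, z, h) A.
     (let x = (1 - \<tau>) *\<^sub>R y + \<tau> *\<^sub>R z;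
          d = sel_matrix A *v (grad f x - h);
          g = h + matrix_inv (Diag p) *v d
      in (x - \<alpha> *\<^sub>R (matrix_inv (Diag p) *v g),
          (1 / (1 + \<beta> * \<mu>)) *\<^sub>R (z + (\<beta> * \<mu>) *\<^sub>R x - \<beta> *\<^sub>R g),
          h + d)))"

lemma asega_Suc:
  "asega f p \<alpha> \<beta> \<tau> \<mu> y0 h0 s (Suc k)
    = asega_step f p \<alpha> \<beta> \<tau> \<mu> (asega f p \<alpha> \<beta> \<tau> \<mu> y0 h0 s k) (s k)"
  by (simp add: asega_step_def Let_def split: prod.split)

text \<open>With \<open>\<beta> = 2 / (75 \<tau> \<eta>\<^sup>2)\<close> the first coefficient is \<open>2 / 75 \<cdot> \<eta>\<^sup>-\<^sup>2 / \<tau>\<^sup>2\<close>. In the form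
  \<open>\<beta> / \<tau>\<close> it is the factor that linear coupling produces.\<close>

definition potential ::
  "(real ^ 'n::finite \<Rightarrow> real) \<Rightarrow> real ^ 'n \<Rightarrow> real ^ 'n \<Rightarrow> real \<Rightarrow> real \<Rightarrow> real \<Rightarrow>
   (real ^ 'n) \<times> (real ^ 'n) \<times> (real ^ 'n) \<Rightarrow> real" where
  "potential f xstar p \<beta> \<tau> \<mu> = (\<lambda>(y, z, h).
     \<beta> / \<tau> * (f y - f xstar) + (1 + \<beta> * \<mu>) / 2 * (norm (z - xstar))\<^sup>2
     + 5 * \<beta>\<^sup>2 * wnorm2 (matrix_inv (Diag p) ** matrix_inv (Diag p)) h)"

text \<open>The mirror move controls the inner product of the gradient with \<open>z - w\<close>, whereas strong
  convexity needs the one with \<open>x - w\<close>. As \<open>x - z\<close> is a multiple of \<open>y - x\<close>, the difference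
  is a change of function value.\<close>

lemma coupling:
  fixes f :: "real ^ 'n::finite \<Rightarrow> real"
  assumes "strongly_convex \<mu> f" "0 \<le> \<mu>" "0 < \<tau>" "\<tau> \<le> 1"
    and x: "x = (1 - \<tau>) *\<^sub>R y + \<tau> *\<^sub>R z"
  shows "f x - f w \<le> (1 - \<tau>) / \<tau> * (f y - f x) + grad f x \<bullet> (z - w) - \<mu> / 2 * (norm (x - w))\<^sup>2"
proof -
  have 1: "f w \<ge> f x + grad f x \<bullet> (w - x) + \<mu> / 2 * (norm (w - x))\<^sup>2" for w
    using assms(1) by (simp add: strongly_convex_def)
  have "grad f x \<bullet> (y - x) \<le> f y - f x"
    using 1[of y] assms(2) by (smt (verit) divide_nonneg_nonneg mult_nonneg_nonneg zero_le_power2)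
  then have "(1 - \<tau>) / \<tau> * (grad f x \<bullet> (y - x)) \<le> (1 - \<tau>) / \<tau> * (f y - f x)"
    using assms by (intro mult_left_mono) auto
  moreover have "(1 - \<tau>) / \<tau> * (grad f x \<bullet> (y - x)) = grad f x \<bullet> (x - z)"
  proof -
    have "(1 - \<tau>) *\<^sub>R (y - x) = \<tau> *\<^sub>R (x - z)"
      unfolding x by (simp add: algebra_simps)
    from arg_cong[OF this, of "inner (grad f x)"]
    have "(1 - \<tau>) * (grad f x \<bullet> (y - x)) = \<tau> * (grad f x \<bullet> (x - z))"
      by (simp only: inner_scaleR_right)
    then show ?thesis
      using \<open>0 < \<tau>\<close> by (simp add: field_simps)
  qed
  ultimately show ?thesis
    using 1[of w] by (simp add: inner_diff_right norm_minus_commute)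
qed

context finite_sampling
begin

text \<open>The constants are tuned so that the squared gradients cancel. With
  \<open>\<beta> \<alpha> / \<tau> = 15 / 2 \<beta>\<^sup>2\<close>, the coefficient of the dual norm of the gradient is
  \<open>1 + 5 - 15 / 2 \<cdot> 4 / 5 = 0\<close> times \<open>\<beta>\<^sup>2\<close>, and that of the dual norm of \<open>h\<close> is
  \<open>1 - 5 + 15 / 2 \<cdot> 1 / 5 = - 5 / 2\<close> times \<open>\<beta>\<^sup>2\<close>. The latter pays for the decrease of the
  last term of the potential. The equation for \<open>\<tau>\<close> says \<open>(1 - \<tau>) (1 + \<beta> \<mu>) = 1\<close>, so the
  other two terms decrease by the factor \<open>1 - \<tau>\<close>.\<close>

lemma mean_potential_step:
  assumes M: "psd M" "matrix_smooth M f"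
    and eso: "\<And>u. wnorm2 (hadamard pair_matrix M) u \<le> (\<Sum>i\<in>UNIV. p $ i * v $ i * (u $ i)\<^sup>2)"
    and v: "\<And>i. v $ i \<le> \<eta>\<^sup>2 * (p $ i)\<^sup>2"
    and f: "strongly_convex \<mu> f" "0 < \<mu>" "\<And>x. f xstar \<le> f x"
    and "0 < \<eta>" and \<tau>: "0 < \<tau>" "\<tau> < 1" "\<tau>\<^sup>2 = 2 / 75 * (\<mu> / \<eta>\<^sup>2) * (1 - \<tau>)"
    and \<alpha>: "\<alpha> = 1 / (5 * \<eta>\<^sup>2)" and \<beta>: "\<beta> = 2 / (75 * \<tau> * \<eta>\<^sup>2)"
    and r: "r \<le> \<tau>" "\<And>i. 2 * r \<le> p $ i"
  shows "mean (\<lambda>A. potential f xstar p \<beta> \<tau> \<mu> (asega_step f p \<alpha> \<beta> \<tau> \<mu> s A))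
    \<le> (1 - r) * potential f xstar p \<beta> \<tau> \<mu> s"
proof (cases s)
  case (fields y z h)
  define x where "x = (1 - \<tau>) *\<^sub>R y + \<tau> *\<^sub>R z"
  define d where "d = grad f x"
  define a where "a = dual_norm2 d"
  define b where "b = dual_norm2 h"
  define w where "w = wnorm2 (matrix_inv (Diag p) ** matrix_inv (Diag p))"
  define Y where "Y = mean (\<lambda>A. f (x - \<alpha> *\<^sub>R (matrix_inv (Diag p) *v estimate d h A)))"
  define Z where "Z = mean (\<lambda>A. (1 + \<beta> * \<mu>) / 2 *
    (norm ((1 / (1 + \<beta> * \<mu>)) *\<^sub>R (z + (\<beta> * \<mu>) *\<^sub>R x - \<beta> *\<^sub>R estimate d h A) - xstar))\<^sup>2)"
  define N where "N = (norm (z - xstar))\<^sup>2"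
  have "0 < \<beta>"
    using \<tau> \<open>0 < \<eta>\<close> by (simp add: \<beta>)
  have \<beta>\<mu>: "(1 - \<tau>) * (1 + \<beta> * \<mu>) = 1"
  proof -
    have "\<tau> * (\<beta> * \<mu> * (1 - \<tau>)) = \<tau> * \<tau>"
      using \<tau>(1) \<tau>(3) \<open>0 < \<eta>\<close> by (simp add: \<beta> power2_eq_square)
    then have "\<beta> * \<mu> * (1 - \<tau>) = \<tau>"
      using \<tau>(1) by simp
    moreover have "(1 - \<tau>) * (1 + \<beta> * \<mu>) = 1 - \<tau> + \<beta> * \<mu> * (1 - \<tau>)"
      by (simp add: algebra_simps)
    ultimately show ?thesis
      by simp
  qed
  have \<alpha>\<eta>: "\<alpha>\<^sup>2 * \<eta>\<^sup>2 = \<alpha> / 5" and \<alpha>\<beta>: "\<beta> / \<tau> * \<alpha> = 15 / 2 * \<beta>\<^sup>2"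
    using \<open>0 < \<eta>\<close> \<tau>(1) by (simp_all add: \<alpha> \<beta> power2_eq_square field_simps)
  have Y_le: "Y \<le> f x - 4 / 5 * \<alpha> * a + 1 / 5 * \<alpha> * b"
    using mean_gradient_move[OF M eso v, where x = x and \<alpha> = \<alpha> and h = h]
    by (simp add: Y_def d_def a_def b_def \<alpha>\<eta> algebra_simps)
  have Z_le: "Z \<le> 1 / 2 * N + \<beta> * \<mu> / 2 * (norm (x - xstar))\<^sup>2 - \<beta> * (d \<bullet> (z - xstar)) + \<beta>\<^sup>2 * (a + b)"
    unfolding Z_def N_def a_def b_def
    using \<open>0 < \<beta>\<close> \<open>0 < \<mu>\<close> by (intro mean_mirror_move) simp
  have "\<beta> * (f x - f xstar)
      \<le> \<beta> * ((1 - \<tau>) / \<tau> * (f y - f x) + d \<bullet> (z - xstar) - \<mu> / 2 * (norm (x - xstar))\<^sup>2)"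
    using coupling[OF f(1) _ \<tau>(1) _ x_def, of xstar] \<open>0 < \<beta>\<close> \<open>0 < \<mu>\<close> \<tau>(2)
    by (intro mult_left_mono) (simp_all add: d_def)
  also have "\<dots> = \<beta> / \<tau> * (1 - \<tau>) * (f y - f xstar) - (\<beta> / \<tau> - \<beta>) * (f x - f xstar)
      + \<beta> * (d \<bullet> (z - xstar)) - \<beta> * \<mu> / 2 * (norm (x - xstar))\<^sup>2"
    using \<tau>(1) by (simp add: field_simps)
  finally have "\<beta> / \<tau> * (f x - f xstar) + Z
      \<le> \<beta> / \<tau> * (1 - \<tau>) * (f y - f xstar) + 1 / 2 * N + \<beta>\<^sup>2 * (a + b)"
    using Z_le by (simp add: algebra_simps)
  moreover have "\<beta> / \<tau> * (Y - f xstar) \<le> \<beta> / \<tau> * (f x - f xstar) - 6 * \<beta>\<^sup>2 * a + 3 / 2 * \<beta>\<^sup>2 * b"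
  proof -
    have "\<beta> / \<tau> * (Y - f xstar) \<le> \<beta> / \<tau> * (f x - f xstar - 4 / 5 * \<alpha> * a + 1 / 5 * \<alpha> * b)"
      using Y_le \<open>0 < \<beta>\<close> \<tau>(1) by (intro mult_left_mono) auto
    also have "\<dots> = \<beta> / \<tau> * (f x - f xstar) - 4 / 5 * (\<beta> / \<tau> * \<alpha>) * a + 1 / 5 * (\<beta> / \<tau> * \<alpha>) * b"
      by (simp add: algebra_simps)
    finally show ?thesis
      unfolding \<alpha>\<beta> by simp
  qed
  ultimately have main: "\<beta> / \<tau> * (Y - f xstar) + Z + 5 * \<beta>\<^sup>2 * (w h - b + a)
      \<le> \<beta> / \<tau> * (1 - \<tau>) * (f y - f xstar) + 1 / 2 * N + 5 * \<beta>\<^sup>2 * (w h - b / 2)"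
    by (simp add: algebra_simps)
  have "mean (\<lambda>A. potential f xstar p \<beta> \<tau> \<mu> (asega_step f p \<alpha> \<beta> \<tau> \<mu> s A))
      = mean (\<lambda>A. \<beta> / \<tau> * (f (x - \<alpha> *\<^sub>R (matrix_inv (Diag p) *v estimate d h A)) - f xstar)
          + (1 + \<beta> * \<mu>) / 2 *
              (norm ((1 / (1 + \<beta> * \<mu>)) *\<^sub>R (z + (\<beta> * \<mu>) *\<^sub>R x - \<beta> *\<^sub>R estimate d h A) - xstar))\<^sup>2
          + 5 * \<beta>\<^sup>2 * w (h + sel_matrix A *v (d - h)))"
    unfolding fields
    by (simp add: potential_def asega_step_def Let_def estimate_def x_def d_def w_def)
  also have "\<dots> = \<beta> / \<tau> * (Y - f xstar) + Z + 5 * \<beta>\<^sup>2 * (w h - b + a)"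
    unfolding Y_def Z_def w_def a_def b_def mean_control_update[symmetric]
    by (simp only: mean_add mean_diff mean_mult mean_const)
  also note main
  also have "\<beta> / \<tau> * (1 - \<tau>) * (f y - f xstar) \<le> (1 - r) * (\<beta> / \<tau> * (f y - f xstar))"
  proof -
    have "0 \<le> \<beta> / \<tau> * (f y - f xstar)"
      using \<open>0 < \<beta>\<close> \<tau>(1) f(3)[of y] by simp
    then have "(1 - \<tau>) * (\<beta> / \<tau> * (f y - f xstar)) \<le> (1 - r) * (\<beta> / \<tau> * (f y - f xstar))"
      using r(1) by (intro mult_right_mono) auto
    then show ?thesis
      by (simp add: mult_ac)
  qed
  also have "1 / 2 * N \<le> (1 - r) * ((1 + \<beta> * \<mu>) / 2 * N)"
  proof -
    have "(1 - \<tau>) * ((1 + \<beta> * \<mu>) / 2 * N) \<le> (1 - r) * ((1 + \<beta> * \<mu>) / 2 * N)"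
      using r(1) \<open>0 < \<beta>\<close> \<open>0 < \<mu>\<close> by (intro mult_right_mono) (auto simp: N_def)
    moreover have "(1 - \<tau>) * ((1 + \<beta> * \<mu>) / 2 * N) = ((1 - \<tau>) * (1 + \<beta> * \<mu>)) / 2 * N"
      by simp
    ultimately show ?thesis
      by (simp only: \<beta>\<mu>)
  qed
  also have "5 * \<beta>\<^sup>2 * (w h - b / 2) \<le> (1 - r) * (5 * \<beta>\<^sup>2 * w h)"
  proof -
    have "5 * \<beta>\<^sup>2 * (w h - b / 2) \<le> 5 * \<beta>\<^sup>2 * (w h - r * w h)"
      using dual_norm2_ge_weighted[OF r(2), of h]
      by (intro mult_left_mono) (simp_all add: w_def b_def)
    then show ?thesis
      by (simp add: algebra_simps)
  qed
  finally show ?thesis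
    by (simp add: fields potential_def N_def w_def distrib_left)
qed

end

section \<open>Recursions driven by independent draws\<close>

text \<open>The state before the \<open>k\<close>-th draw is a function of the earlier draws, hence
  independent of the \<open>k\<close>-th one. Since all draws are finite-valued, every function of a
  state takes finitely many values and is measurable, hence integrable.\<close>

locale driven_recursion = prob_space M for M :: "'w measure" +
  fixes X :: "nat \<Rightarrow> 'w \<Rightarrow> 'b" and D :: "nat \<Rightarrow> 'w \<Rightarrow> 'a::finite"
    and x0 :: 'b and step :: "'b \<Rightarrow> 'a \<Rightarrow> 'b"
  assumes indep: "indep_vars (\<lambda>_. count_space UNIV) D UNIV"
    and X_0: "X 0 \<omega> = x0"
    and X_Suc: "X (Suc k) \<omega> = step (X k \<omega>) (D k \<omega>)"
begin

lemma measurable_draw: "D k \<in> M \<rightarrow>\<^sub>M count_space UNIV"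
  using indep by (simp add: indep_vars_def)

lemma indep_state_draw:
  fixes \<phi> :: "'b \<Rightarrow> real" and \<psi> :: "'a \<Rightarrow> real"
  shows "indep_var borel (\<lambda>\<omega>. \<phi> (X k \<omega>)) borel (\<lambda>\<omega>. \<psi> (D k \<omega>))"
proof -
  define G where "G = (\<lambda>n g. rec_nat x0 (\<lambda>i x. step x (g i)) n)"
  have past: "G n (restrict (\<lambda>i. D i \<omega>) {..<k}) = X n \<omega>" if "n \<le> k" for n \<omega>
    using that by (induction n) (simp_all add: G_def X_0 X_Suc)
  have "PiM {..<k} (\<lambda>_. count_space (UNIV :: 'a set)) = count_space (PiE {..<k} (\<lambda>_. UNIV))"
    by (rule count_space_PiM_finite) (simp_all add: countable_finite)
  then have G: "(\<lambda>g. \<phi> (G k g)) \<in> borel_measurable (PiM {..<k} (\<lambda>_. count_space (UNIV :: 'a set)))"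
    by simp
  have "indep_var (PiM {..<k} (\<lambda>_. count_space UNIV)) (\<lambda>\<omega>. restrict (\<lambda>i. D i \<omega>) {..<k})
      (PiM {k} (\<lambda>_. count_space UNIV)) (\<lambda>\<omega>. restrict (\<lambda>i. D i \<omega>) {k})"
    using indep by (rule indep_var_restrict) auto
  then have "indep_var borel ((\<lambda>g. \<phi> (G k g)) \<circ> (\<lambda>\<omega>. restrict (\<lambda>i. D i \<omega>) {..<k}))
      borel ((\<lambda>g. \<psi> (g k)) \<circ> (\<lambda>\<omega>. restrict (\<lambda>i. D i \<omega>) {k}))"
    using G
  proof (rule indep_var_compose)
    have "(\<lambda>g. g k) \<in> PiM {k} (\<lambda>_. count_space (UNIV :: 'a set)) \<rightarrow>\<^sub>M count_space UNIV"
      by (rule measurable_component_singleton) simp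
    then show "(\<lambda>g. \<psi> (g k)) \<in> borel_measurable (PiM {k} (\<lambda>_. count_space (UNIV :: 'a set)))"
      by (rule measurable_compose) simp
  qed
  then show ?thesis
    by (simp add: comp_def past)
qed

lemma finite_range_state: "finite (range (X k))"
proof (induction k)
  case 0
  have "range (X 0) \<subseteq> {x0}"
    by (auto simp: X_0)
  then show ?case
    by (rule finite_subset) simp
next
  case (Suc k)
  have "range (X (Suc k)) \<subseteq> (\<lambda>(x, a). step x a) ` (range (X k) \<times> UNIV)"
    by (auto simp: X_Suc)
  then show ?case
    by (rule finite_subset) (simp add: Suc)
qed

lemma integrable_state:
  fixes \<phi> :: "'b \<Rightarrow> real"
  shows "integrable M (\<lambda>\<omega>. \<phi> (X k \<omega>))"
proof (rule integrable_const_bound)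
  have "finite (range (\<lambda>\<omega>. norm (\<phi> (X k \<omega>))))"
    using finite_imageI[OF finite_range_state, of "\<lambda>x. norm (\<phi> x)" k] by (simp add: image_image)
  then show "AE \<omega> in M. norm (\<phi> (X k \<omega>)) \<le> Max (range (\<lambda>\<omega>. norm (\<phi> (X k \<omega>))))"
    by simp
  show "(\<lambda>\<omega>. \<phi> (X k \<omega>)) \<in> borel_measurable M"
    by (rule indep_var_rv1[OF indep_state_draw])
qed

lemma expectation_state_Suc:
  fixes \<phi> :: "'b \<Rightarrow> real"
  shows "expectation (\<lambda>\<omega>. \<phi> (X (Suc k) \<omega>))
    = expectation (\<lambda>\<omega>. \<Sum>a\<in>UNIV. prob {\<omega> \<in> space M. D k \<omega> = a} * \<phi> (step (X k \<omega>) a))"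
proof -
  have int: "integrable M (\<lambda>\<omega>. \<phi> (step (X k \<omega>) a))" for a
    by (rule integrable_state)
  have ind: "integrable M (\<lambda>\<omega>. indicator {a} (D k \<omega>) :: real)" for a
    by (rule integrable_const_bound[of _ 1])
      (use measurable_compose[OF measurable_draw, of "indicator {a}" borel] in auto)
  have prob: "expectation (\<lambda>\<omega>. indicator {a} (D k \<omega>)) = prob {\<omega> \<in> space M. D k \<omega> = a}" for a
  proof -
    have "expectation (\<lambda>\<omega>. indicator {a} (D k \<omega>))
        = expectation (indicator {\<omega> \<in> space M. D k \<omega> = a} :: 'w \<Rightarrow> real)"
      by (rule Bochner_Integration.integral_cong) (auto simp: indicator_def)
    then show ?thesis
      by (simp add: Collect_conj_eq Int_absorb1 Int_absorb2)
  qed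
  have ind_var: "indep_var borel (\<lambda>\<omega>. \<phi> (step (X k \<omega>) a)) borel (\<lambda>\<omega>. indicator {a} (D k \<omega>) :: real)" for a
    by (rule indep_state_draw)
  have "expectation (\<lambda>\<omega>. \<phi> (X (Suc k) \<omega>))
      = expectation (\<lambda>\<omega>. \<Sum>a\<in>UNIV. \<phi> (step (X k \<omega>) a) * indicator {a} (D k \<omega>))"
    by (simp add: X_Suc indicator_def)
  also have "\<dots> = (\<Sum>a\<in>UNIV. expectation (\<lambda>\<omega>. \<phi> (step (X k \<omega>) a) * indicator {a} (D k \<omega>)))"
    by (intro Bochner_Integration.integral_sum indep_var_integrable[OF ind_var int ind])
  also have "\<dots> = (\<Sum>a\<in>UNIV. prob {\<omega> \<in> space M. D k \<omega> = a} * expectation (\<lambda>\<omega>. \<phi> (step (X k \<omega>) a)))"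
    by (simp add: indep_var_lebesgue_integral[OF ind_var int ind] prob mult.commute)
  also have "\<dots> = expectation (\<lambda>\<omega>. \<Sum>a\<in>UNIV. prob {\<omega> \<in> space M. D k \<omega> = a} * \<phi> (step (X k \<omega>) a))"
    by (subst Bochner_Integration.integral_sum) (simp_all add: int)
  finally show ?thesis .
qed

lemma expectation_geometric_decay:
  fixes \<phi> :: "'b \<Rightarrow> real"
  assumes "0 \<le> c"
    and decay: "\<And>k x. (\<Sum>a\<in>UNIV. prob {\<omega> \<in> space M. D k \<omega> = a} * \<phi> (step x a)) \<le> c * \<phi> x"
  shows "expectation (\<lambda>\<omega>. \<phi> (X k \<omega>)) \<le> c ^ k * expectation (\<lambda>\<omega>. \<phi> (X 0 \<omega>))"
proof (induction k)
  case (Suc k)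
  have "expectation (\<lambda>\<omega>. \<phi> (X (Suc k) \<omega>)) \<le> expectation (\<lambda>\<omega>. c * \<phi> (X k \<omega>))"
    unfolding expectation_state_Suc
    by (intro integral_mono decay integrable_mult_right integrable_state
        integrable_state[of "\<lambda>x. \<Sum>a\<in>UNIV. prob {\<omega> \<in> space M. D k \<omega> = a} * \<phi> (step x a)"])
  also have "\<dots> \<le> c * (c ^ k * expectation (\<lambda>\<omega>. \<phi> (X 0 \<omega>)))"
    using mult_left_mono[OF Suc assms(1)] by simp
  finally show ?case
    by (simp add: mult_ac)
qed simp

end

section \<open>Linear convergence\<close>

lemma finite_sampling_law:
  assumes "proper_sampling \<Omega> S"
  defines "q \<equiv> \<lambda>A. measure \<Omega> {\<omega> \<in> space \<Omega>. S \<omega> = A}"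
  shows "finite_sampling q (prob_vector \<Omega> S)"
    and "finite_sampling.pair_matrix q = prob_matrix \<Omega> S"
proof -
  interpret prob_space \<Omega>
    using assms(1) by (simp add: proper_sampling_def sampling_def)
  have S: "S \<in> \<Omega> \<rightarrow>\<^sub>M count_space UNIV"
    using assms(1) by (simp add: proper_sampling_def sampling_def)
  have ev: "{\<omega> \<in> space \<Omega>. P (S \<omega>)} \<in> sets \<Omega>" for P
    using measurable_sets[OF S, of "Collect P"] by (simp add: vimage_def Int_def conj_commute)
  have sum_q: "(\<Sum>A | P A. q A) = prob {\<omega> \<in> space \<Omega>. P (S \<omega>)}" for P
  proof -
    have "{\<omega> \<in> space \<Omega>. S \<omega> = A} \<in> sets \<Omega>" for A
      by (rule ev)
    then have "(\<Sum>A | P A. q A) = prob (\<Union>A\<in>Collect P. {\<omega> \<in> space \<Omega>. S \<omega> = A})"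
      unfolding q_def
      by (intro finite_measure_finite_Union[symmetric]) (auto simp: disjoint_family_on_def)
    also have "(\<Union>A\<in>Collect P. {\<omega> \<in> space \<Omega>. S \<omega> = A}) = {\<omega> \<in> space \<Omega>. P (S \<omega>)}"
      by auto
    finally show ?thesis .
  qed
  show fs: "finite_sampling q (prob_vector \<Omega> S)"
  proof
    show "0 \<le> q A" for A
      by (simp add: q_def)
    show "(\<Sum>A\<in>UNIV. q A) = 1"
      using sum_q[of "\<lambda>_. True"] by (simp add: prob_space)
    show "prob_vector \<Omega> S $ i = (\<Sum>A | i \<in> A. q A)" for i
      by (simp add: prob_vector_def sum_q)
    show "0 < prob_vector \<Omega> S $ i" for i
      using assms(1) by (simp add: proper_sampling_def)
  qed
  show "finite_sampling.pair_matrix q = prob_matrix \<Omega> S"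
    unfolding finite_sampling.pair_matrix_def[OF fs] prob_matrix_def
    by (simp only: sum_q)
qed

lemma loewner_le_wnorm2: "loewner_le A B \<Longrightarrow> wnorm2 A u \<le> wnorm2 B u"
  by (simp add: loewner_le_def psd_def wnorm2_def matrix_vector_mult_diff_rdistrib inner_diff_right)

text \<open>Testing the matrix inequality with a unit vector gives \<open>M\<^sub>i\<^sub>i \<le> v\<^sub>i\<close>.\<close>

lemma eso_parameter_pos:
  fixes M P :: "real ^ 'n::finite ^ 'n"
  assumes "pos_def M" and "P $ i $ i = p $ i" and "0 < p $ i"
    and "loewner_le (hadamard P M) (Diag p ** Diag v)"
  shows "0 < v $ i"
proof -
  have axis: "wnorm2 A (axis i 1) = A $ i $ i" for A :: "real ^ 'n ^ 'n"
    by (simp add: wnorm2_def inner_axis' matrix_vector_mult_basis column_def)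
  have "0 < M $ i $ i"
    using assms(1) axis[of M] unfolding pos_def_def wnorm2_def
    by (metis axis_eq_0_iff zero_neq_one)
  then have "0 < p $ i * M $ i $ i"
    using assms(3) by simp
  also have "\<dots> \<le> p $ i * v $ i"
    using loewner_le_wnorm2[OF assms(4), of "axis i 1"] assms(2)
    by (simp add: axis hadamard_def Diag_mult_Diag) (simp add: Diag_def)
  finally show ?thesis
    using assms(3) by (simp add: zero_less_mult_iff)
qed

text \<open>With \<open>a = 2 \<mu> / (75 \<eta>\<^sup>2)\<close>, the parameter \<open>\<tau>\<close> is the positive root of this equation, and
  \<open>\<beta> \<mu> = a / \<tau> = \<tau> / (1 - \<tau>)\<close>.\<close>

lemma quadratic_root:
  fixes a \<tau> :: real
  assumes "0 < a" and \<tau>: "\<tau> = (sqrt (a\<^sup>2 + 4 * a) - a) / 2"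
  shows "\<tau>\<^sup>2 = a * (1 - \<tau>)" and "0 < \<tau>" and "\<tau> < 1"
proof -
  have sq: "(sqrt (a\<^sup>2 + 4 * a))\<^sup>2 = a\<^sup>2 + 4 * a"
    using assms(1) by simp
  then show 1: "\<tau>\<^sup>2 = a * (1 - \<tau>)"
    unfolding \<tau> by (simp add: power2_eq_square field_simps)
  have "sqrt (a\<^sup>2) < sqrt (a\<^sup>2 + 4 * a)"
    using assms(1) by (intro real_sqrt_less_mono) simp
  then show "0 < \<tau>"
    using assms(1) by (simp add: \<tau>)
  then have "0 < a * (1 - \<tau>)"
    unfolding 1[symmetric] by simp
  then show "\<tau> < 1"
    using assms(1) by (simp add: zero_less_mult_iff)
qed

theorem theoremB5:
  fixes f :: "real ^ 'n::finite \<Rightarrow> real"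
    and M P :: "real ^ 'n ^ 'n"
    and xstar y0 h0 v p :: "real ^ 'n"
    and \<mu> \<eta> c1 \<alpha> \<beta> \<tau> \<sigma> :: real
    and \<Omega> :: "'w measure"
    and S :: "'w \<Rightarrow> 'n set"
    and Sk :: "nat \<Rightarrow> 'w \<Rightarrow> 'n set"
    and y z h :: "nat \<Rightarrow> 'w \<Rightarrow> real ^ 'n"
    and \<Upsilon> :: "nat \<Rightarrow> real"
    and k :: nat
  assumes "pos_def M" and "matrix_smooth M f"
    and "\<mu> > 0" and "strongly_convex \<mu> f"
    and "is_arg_min f (\<lambda>_. True) xstar"
    and "proper_sampling \<Omega> S"
    and "p = prob_vector \<Omega> S" and "P = prob_matrix \<Omega> S"
    and "loewner_le (hadamard P M) (Diag p ** Diag v)"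
    and "independent_copies \<Omega> S Sk"
    and "\<eta> = (MAX i. sqrt (v $ i) / p $ i)"
    and "c1 = max 1 (inverse \<eta> * (sqrt \<mu> / (MIN i. p $ i)))"
    and "\<alpha> = 1 / (5 * \<eta>\<^sup>2)"
    and "\<tau> = (sqrt (4 / (9 * 5 ^ 4) * inverse \<eta> ^ 4 * \<mu>\<^sup>2 + 8 / 75 * (inverse \<eta>)\<^sup>2 * \<mu>)
              - 2 / 75 * (inverse \<eta>)\<^sup>2 * \<mu>) / 2"
    and "\<beta> = 2 / (75 * \<tau> * \<eta>\<^sup>2)"
    and "\<sigma> = 5 * \<beta>\<^sup>2"
    and "\<And>j \<omega>. (y j \<omega>, z j \<omega>, h j \<omega>) = asega f p \<alpha> \<beta> \<tau> \<mu> y0 h0 (\<lambda>i. Sk i \<omega>) j"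
    and "\<And>j. \<Upsilon> j =
           2 / 75 * ((inverse \<eta>)\<^sup>2 / \<tau>\<^sup>2) * ((\<integral>\<omega>. f (y j \<omega>) \<partial>\<Omega>) - f xstar)
           + (1 + \<beta> * \<mu>) / 2 * (\<integral>\<omega>. (norm (z j \<omega> - xstar))\<^sup>2 \<partial>\<Omega>)
           + \<sigma> * (\<integral>\<omega>. wnorm2 (matrix_inv (Diag p) ** matrix_inv (Diag p)) (h j \<omega>) \<partial>\<Omega>)"
  shows "\<Upsilon> k \<le> (1 - inverse c1 * \<tau>) ^ k * \<Upsilon> 0"
proof -
  define q where "q = (\<lambda>A. measure \<Omega> {\<omega> \<in> space \<Omega>. S \<omega> = A})"
  have fs: "finite_sampling q p" and P: "finite_sampling.pair_matrix q = P"
    using finite_sampling_law[OF assms(6)] by (simp_all add: q_def assms(7,8))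
  interpret finite_sampling q p
    by (rule fs)
  interpret \<Omega>: prob_space \<Omega>
    using assms(6) by (simp add: proper_sampling_def sampling_def)

  have M: "psd M"
    using assms(1) unfolding psd_def pos_def_def by (metis inner_zero_left less_eq_real_def)
  have eso: "wnorm2 (hadamard pair_matrix M) u \<le> (\<Sum>i\<in>UNIV. p $ i * v $ i * (u $ i)\<^sup>2)" for u
    using loewner_le_wnorm2[OF assms(9), of u] by (simp add: P Diag_mult_Diag wnorm2_Diag)
  have v_pos: "0 < v $ i" for i
    by (rule eso_parameter_pos[OF assms(1) _ p_pos assms(9)])
      (simp add: assms(7,8) prob_matrix_def prob_vector_def)
  have \<eta>_ge: "sqrt (v $ i) / p $ i \<le> \<eta>" for i
    unfolding assms(11) by (rule Max_ge) auto
  then have \<eta>: "0 < \<eta>"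
    using v_pos p_pos by (meson divide_pos_pos less_le_trans real_sqrt_gt_zero)
  have v_le: "v $ i \<le> \<eta>\<^sup>2 * (p $ i)\<^sup>2" for i
  proof -
    have "sqrt (v $ i) \<le> \<eta> * p $ i"
      using \<eta>_ge[of i] p_pos[of i] by (simp add: field_simps)
    then have "(sqrt (v $ i))\<^sup>2 \<le> (\<eta> * p $ i)\<^sup>2"
      by (rule power_mono) (simp add: v_pos less_imp_le)
    then show ?thesis
      using v_pos[of i] by (simp add: power_mult_distrib)
  qed

  define a where "a = 2 / 75 * (\<mu> / \<eta>\<^sup>2)"
  have "0 < a"
    using \<eta> assms(3) by (simp add: a_def)
  have "\<tau> = (sqrt (a\<^sup>2 + 4 * a) - a) / 2"
  proof -
    have "4 / (9 * 5 ^ 4) * inverse \<eta> ^ 4 * \<mu>\<^sup>2 = a\<^sup>2"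
      using \<eta> by (simp add: a_def field_simps)
    moreover have "8 / 75 * (inverse \<eta>)\<^sup>2 * \<mu> = 4 * a" and "2 / 75 * (inverse \<eta>)\<^sup>2 * \<mu> = a"
      using \<eta> by (simp_all add: a_def field_simps)
    ultimately show ?thesis
      unfolding assms(14) by (simp only:)
  qed
  note \<tau> = quadratic_root[OF \<open>0 < a\<close> this]

  define m where "m = (MIN i. p $ i)"
  have m_le: "m \<le> p $ i" for i
    unfolding m_def by (rule Min_le) auto
  have "m \<in> range (\<lambda>i. p $ i)"
    unfolding m_def by (rule Min_in) auto
  then have "0 < m"
    using p_pos by auto
  have "1 \<le> c1"
    by (simp add: assms(12))
  define r where "r = inverse c1 * \<tau>"
  have "r \<le> \<tau>"
    using \<open>1 \<le> c1\<close> \<tau>(2) by (simp add: r_def field_simps)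
  have "2 * r \<le> m"
  proof -
    \<comment> \<open>Weakening the constant \<open>2 / 75\<close> in \<open>a\<close> to the square \<open>1 / 4\<close> yields the factor 2 needed.\<close>
    have "\<tau>\<^sup>2 \<le> a"
      using \<tau> \<open>0 < a\<close> by (simp add: mult_left_le)
    also have "a \<le> 1 / 4 * (\<mu> / \<eta>\<^sup>2)"
      unfolding a_def using assms(3) by (intro mult_right_mono) auto
    also have "\<dots> = (sqrt \<mu> / (2 * \<eta>))\<^sup>2"
      using assms(3) by (simp add: power_divide power_mult_distrib)
    finally have "\<tau> \<le> sqrt \<mu> / (2 * \<eta>)"
      by (rule power2_le_imp_le) (use \<eta> assms(3) in simp)
    then have "2 * \<tau> \<le> inverse \<eta> * (sqrt \<mu> / m) * m"
      using \<open>0 < m\<close> \<eta> by (simp add: field_simps)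
    also have "\<dots> \<le> c1 * m"
      using \<open>0 < m\<close> by (intro mult_right_mono) (simp_all add: assms(12) flip: m_def)
    finally show ?thesis
      using \<open>1 \<le> c1\<close> by (simp add: r_def field_simps)
  qed

  let ?X = "\<lambda>j \<omega>. asega f p \<alpha> \<beta> \<tau> \<mu> y0 h0 (\<lambda>i. Sk i \<omega>) j"
  let ?\<Psi> = "potential f xstar p \<beta> \<tau> \<mu>"
  interpret driven_recursion \<Omega> ?X Sk "(y0, y0, h0)" "asega_step f p \<alpha> \<beta> \<tau> \<mu>"
    by standard (use assms(10) in \<open>simp_all add: independent_copies_def asega_Suc del: asega.simps(2)\<close>)

  have law: "measure \<Omega> {\<omega> \<in> space \<Omega>. Sk j \<omega> = A} = q A" for j A
  proof -
    have S: "S \<in> \<Omega> \<rightarrow>\<^sub>M count_space UNIV"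
      using assms(6) by (simp add: proper_sampling_def sampling_def)
    have Sk: "Sk j \<in> \<Omega> \<rightarrow>\<^sub>M count_space UNIV"
      by (rule measurable_draw)
    have "measure (distr \<Omega> (count_space UNIV) (Sk j)) {A} = measure (distr \<Omega> (count_space UNIV) S) {A}"
      using assms(10) by (simp add: independent_copies_def)
    then show ?thesis
      by (simp add: measure_distr S Sk q_def vimage_def Int_def conj_commute)
  qed
  have decay: "\<Omega>.expectation (\<lambda>\<omega>. ?\<Psi> (?X k \<omega>))
      \<le> (1 - r) ^ k * \<Omega>.expectation (\<lambda>\<omega>. ?\<Psi> (?X 0 \<omega>))"
  proof (rule expectation_geometric_decay)
    show "0 \<le> 1 - r"
      using \<open>r \<le> \<tau>\<close> \<tau>(3) by simp
    have "mean (\<lambda>A. ?\<Psi> (asega_step f p \<alpha> \<beta> \<tau> \<mu> s A)) \<le> (1 - r) * ?\<Psi> s" for s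
    proof (rule mean_potential_step[OF M assms(2) eso v_le assms(4) assms(3) _ \<eta> \<tau>(2,3) _
          assms(13) assms(15) \<open>r \<le> \<tau>\<close>])
      show "f xstar \<le> f x" for x
        using assms(5) by (simp add: is_arg_min_linorder)
      show "\<tau>\<^sup>2 = 2 / 75 * (\<mu> / \<eta>\<^sup>2) * (1 - \<tau>)"
        using \<tau>(1) by (simp add: a_def)
      show "2 * r \<le> p $ i" for i
        using \<open>2 * r \<le> m\<close> m_le[of i] by simp
    qed
    then show "(\<Sum>A\<in>UNIV. measure \<Omega> {\<omega> \<in> space \<Omega>. Sk j \<omega> = A}
        * ?\<Psi> (asega_step f p \<alpha> \<beta> \<tau> \<mu> s A)) \<le> (1 - r) * ?\<Psi> s" for j s
      by (simp add: law mean_def)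
  qed
  have "\<Omega>.expectation (\<lambda>\<omega>. ?\<Psi> (?X j \<omega>)) = \<Upsilon> j" for j
  proof -
    have X: "?X j \<omega> = (y j \<omega>, z j \<omega>, h j \<omega>)" for \<omega>
      using assms(17)[of j \<omega>] by simp
    have y: "integrable \<Omega> (\<lambda>\<omega>. \<phi> (y j \<omega>))" and z: "integrable \<Omega> (\<lambda>\<omega>. \<phi> (z j \<omega>))"
      and h: "integrable \<Omega> (\<lambda>\<omega>. \<phi> (h j \<omega>))" for \<phi> :: "real ^ 'n \<Rightarrow> real"
      using integrable_state[of "\<lambda>s. \<phi> (fst s)" j] integrable_state[of "\<lambda>s. \<phi> (fst (snd s))" j]
        integrable_state[of "\<lambda>s. \<phi> (snd (snd s))" j] by (simp_all add: X)
    have "\<beta> / \<tau> = 2 / 75 * ((inverse \<eta>)\<^sup>2 / \<tau>\<^sup>2)"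
      using \<eta> \<tau>(2) unfolding assms(15) by (simp add: power2_eq_square field_simps)
    moreover have "\<Omega>.expectation (\<lambda>\<omega>. f (y j \<omega>) - f xstar) = \<Omega>.expectation (\<lambda>\<omega>. f (y j \<omega>)) - f xstar"
      using y[of f] by (simp add: \<Omega>.prob_space)
    ultimately show ?thesis
      unfolding assms(18) X potential_def prod.case assms(16)
      by (simp add: y[of "\<lambda>y. f y - f xstar"] z[of "\<lambda>z. (norm (z - xstar))\<^sup>2"] h)
  qed
  then show ?thesis
    using decay unfolding r_def by (simp only:)
qed

end
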